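(* Let $V=V(4,3)=\mathbb{F}_3^4$ and let $(M,G,V,\mathcal{E})$ be a homogeneous factorisation of $K_{81}=(V,E)$ of index $5$ with factors $\Gamma_b=\mathrm{Cay}(V,S_b)$ ($1\le b\le5$), in which $M$ is arc-transitive on each factor, where $G=T\rtimes G_0$ is affine $2$-transitive on $V$ with $G_0\le GL(4,3)$ having a normal extraspecial subgroup $\mathbf{E}$ of order $2^5$ with $G_0/\mathbf{E}$ isomorphic to a subgroup of $S_5$, and $M=T\rtimes\mathbf{E}$. Then $\Gamma_b\cong H(9,2)$ for all $b$.
   Context: A homogeneous factorisation of index $k>1$ of $K_n=(V,E)$ is a 4-tuple $(M,G,V,\mathcal{E})$ where $\mathcal{E}$ partitions the 2-subsets of $V$ into $k$ parts, $G\le\mathrm{Sym}(V)$ is transitive on $V$, leaves $\mathcal{E}$ invariant and permutes its parts transitively, and the kernel $M$ of this action is transitive on $V$; factors are $(V,E_i)$. $T$ is the translation group of $V$. $\mathrm{Cay}(V,S)$ has edges $\{u,v\}$ with $v-u\in S$. The Hamming graph $H(9,2)$ has vertices the pairs from a 9-element set, adjacent iff they differ in exactly one coordinate. *)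

theory Defs
  imports
    "HOL-Analysis.Cartesian_Space"
    "HOL-Algebra.Group_Action"
    "HOL-Algebra.Sym_Groups"
    "HOL-Library.Disjoint_Sets"
    "HOL-Computational_Algebra.Primes"
begin

section \<open>Graphs\<close>

type_synonym 'v graph = "'v set \<times> 'v set set"

definition graph_iso :: "'v graph \<Rightarrow> 'w graph \<Rightarrow> bool" where
  "graph_iso \<Gamma> \<Delta> \<longleftrightarrow>
     (\<exists>f. bij_betw f (fst \<Gamma>) (fst \<Delta>) \<and>
          (\<forall>u\<in>fst \<Gamma>. \<forall>v\<in>fst \<Gamma>. {u, v} \<in> snd \<Gamma> \<longleftrightarrow> {f u, f v} \<in> snd \<Delta>))"

definition graph_Aut :: "'v graph \<Rightarrow> ('v \<Rightarrow> 'v) set" where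
  "graph_Aut \<Gamma> = {g \<in> Bij (fst \<Gamma>).
     \<forall>u\<in>fst \<Gamma>. \<forall>v\<in>fst \<Gamma>. {u, v} \<in> snd \<Gamma> \<longleftrightarrow> {g u, g v} \<in> snd \<Gamma>}"

definition arcs :: "'v graph \<Rightarrow> ('v \<times> 'v) set" where
  "arcs \<Gamma> = {(u, v). u \<in> fst \<Gamma> \<and> v \<in> fst \<Gamma> \<and> {u, v} \<in> snd \<Gamma>}"

definition arc_transitive :: "('v \<Rightarrow> 'v) set \<Rightarrow> 'v graph \<Rightarrow> bool" where
  "arc_transitive M \<Gamma> \<longleftrightarrow> M \<subseteq> graph_Aut \<Gamma> \<and>
     (\<forall>(u, v)\<in>arcs \<Gamma>. \<forall>(x, y)\<in>arcs \<Gamma>. \<exists>g\<in>M. g u = x \<and> g v = y)"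

definition Cay :: "'v::ab_group_add set \<Rightarrow> 'v set \<Rightarrow> 'v graph" where
  "Cay V S = (V, {{u, v} | u v. u \<in> V \<and> v \<in> V \<and> v - u \<in> S})"

text \<open>The Hamming graph usually written \<open>H(q,2)\<close>, on pairs over a \<open>q\<close>-element set.\<close>

definition Hamming2 :: "nat \<Rightarrow> (nat \<times> nat) graph" where
  "Hamming2 q = ({..<q} \<times> {..<q},
     {{(a, b), (c, d)} | a b c d. a < q \<and> b < q \<and> c < q \<and> d < q \<and>
        (a \<noteq> c \<and> b = d \<or> a = c \<and> b \<noteq> d)})"

section \<open>Permutation groups and homogeneous factorisations\<close>

abbreviation perm_group :: "'v set \<Rightarrow> ('v \<Rightarrow> 'v) set \<Rightarrow> ('v \<Rightarrow> 'v) monoid" where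
  "perm_group V G \<equiv> (BijGroup V)\<lparr>carrier := G\<rparr>"

definition two_transitive :: "('v \<Rightarrow> 'v) set \<Rightarrow> 'v set \<Rightarrow> bool" where
  "two_transitive G V \<longleftrightarrow>
     (\<forall>u\<in>V. \<forall>v\<in>V. \<forall>x\<in>V. \<forall>y\<in>V. u \<noteq> v \<longrightarrow> x \<noteq> y \<longrightarrow> (\<exists>g\<in>G. g u = x \<and> g v = y))"

text \<open>The map induced by \<open>g\<close> on the parts of \<open>\<E>\<close>; it is restricted to \<open>\<E>\<close> because the elements
  of \<^term>\<open>BijGroup \<E>\<close> are extensional functions.\<close>

definition part_action :: "'v set set set \<Rightarrow> ('v \<Rightarrow> 'v) \<Rightarrow> 'v set set \<Rightarrow> 'v set set" where
  "part_action \<E> g = (\<lambda>P\<in>\<E>. (\<lambda>e. g ` e) ` P)"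

text \<open>That \<open>G\<close> leaves \<open>\<E>\<close> invariant is contained in \<^const>\<open>transitive_action\<close>, which demands a
  homomorphism from \<open>G\<close> into \<^term>\<open>BijGroup \<E>\<close>.\<close>

definition homogeneous_factorisation ::
    "nat \<Rightarrow> ('v \<Rightarrow> 'v) set \<Rightarrow> ('v \<Rightarrow> 'v) set \<Rightarrow> 'v set \<Rightarrow> 'v set set set \<Rightarrow> bool" where
  "homogeneous_factorisation k M G V \<E> \<longleftrightarrow>
     finite V \<and> k > 1 \<and>
     partition_on {e. e \<subseteq> V \<and> card e = 2} \<E> \<and> card \<E> = k \<and>
     subgroup G (BijGroup V) \<and>
     transitive_action (perm_group V G) V (\<lambda>g. g) \<and>
     transitive_action (perm_group V G) \<E> (part_action \<E>) \<and>
     M = kernel (perm_group V G) (BijGroup \<E>) (part_action \<E>) \<and>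
     transitive_action (perm_group V M) V (\<lambda>g. g)"

definition factors :: "'v set \<Rightarrow> 'v set set set \<Rightarrow> 'v graph set" where
  "factors V \<E> = {(V, P) | P. P \<in> \<E>}"

section \<open>Affine groups and extraspecial groups\<close>

definition translation_group :: "('f::field ^ 'n \<Rightarrow> 'f ^ 'n) set" where
  "translation_group = range (\<lambda>a v. v + a)"

definition GL :: "('f::field ^ 'n \<Rightarrow> 'f ^ 'n) set" where
  "GL = {(\<lambda>v. A *v v) | A :: 'f ^ 'n ^ 'n. invertible A}"

text \<open>\<open>K\<close> is the internal semidirect product of \<open>N\<close> by \<open>H\<close> in the ambient group \<open>P\<close>.\<close>

definition semidirect :: "('a, 'b) monoid_scheme \<Rightarrow> 'a set \<Rightarrow> 'a set \<Rightarrow> 'a set \<Rightarrow> bool" where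
  "semidirect P K N H \<longleftrightarrow>
     subgroup K P \<and> N \<lhd> P\<lparr>carrier := K\<rparr> \<and> subgroup H (P\<lparr>carrier := K\<rparr>) \<and>
     N \<inter> H = {\<one>\<^bsub>P\<^esub>} \<and> N <#>\<^bsub>P\<^esub> H = K"

definition center :: "('a, 'b) monoid_scheme \<Rightarrow> 'a set" where
  "center G = {z \<in> carrier G. \<forall>x\<in>carrier G. z \<otimes>\<^bsub>G\<^esub> x = x \<otimes>\<^bsub>G\<^esub> z}"

definition elementary_abelian :: "nat \<Rightarrow> ('a, 'b) monoid_scheme \<Rightarrow> bool" where
  "elementary_abelian p G \<longleftrightarrow> comm_group G \<and> (\<forall>x\<in>carrier G. x [^]\<^bsub>G\<^esub> p = \<one>\<^bsub>G\<^esub>)"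

definition extraspecial :: "nat \<Rightarrow> ('a, 'b) monoid_scheme \<Rightarrow> bool" where
  "extraspecial p G \<longleftrightarrow>
     prime p \<and> group G \<and> (\<exists>m. order G = p ^ m) \<and>
     card (center G) = p \<and>
     elementary_abelian p (G Mod center G) \<and> order (G Mod center G) > 1"

end

theory Submission
  imports Defs
begin

text \<open>
  The factors have equal valency, so each connection set \<open>S\<close> is an orbit of the extraspecial group
  \<open>X\<close> of size \<open>80 / 5 = 16\<close> and every nonzero vector has a stabiliser of order 2 in \<open>X\<close>. The central
  involution fixes no nonzero vector, hence it is \<open>-1\<close>. If \<open>t\<close> generates the stabiliser of \<open>v \<in> S\<close>,
  then every element of \<open>X\<close> commutes or anticommutes with \<open>t\<close>, so that \<open>S\<close> lies in the union of the
  eigenspaces \<open>U\<close> and \<open>W\<close> of \<open>t\<close>; an element anticommuting with \<open>t\<close> swaps \<open>U\<close> and \<open>W\<close>. Therefore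
  \<open>|U| = |W| = 9\<close>, and by counting \<open>S = (U \<union> W) - {0}\<close>. The Cayley graph of \<open>U \<oplus> W\<close> with this
  connection set is \<open>H(9,2)\<close>.
\<close>

section \<open>Cayley graphs of direct sums\<close>

lemma Hamming2_edge_iff:
  assumes "x \<in> {..<q} \<times> {..<q}" "y \<in> {..<q} \<times> {..<q}"
  shows "{x, y} \<in> snd (Hamming2 q) \<longleftrightarrow>
    (fst x \<noteq> fst y \<and> snd x = snd y \<or> fst x = fst y \<and> snd x \<noteq> snd y)"
  using assms unfolding Hamming2_def
  by (cases x; cases y) (auto simp: doubleton_eq_iff)

text \<open>An additive idempotent \<open>p\<close> splits the group into its fixed points and its
  kernel. Numbering each summand turns \<open>p v\<close> and \<open>v - p v\<close> into the
  coordinates of \<open>v\<close>: two points share the first coordinate iff \<open>p\<close> kills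
  their difference, and the second iff \<open>p\<close> fixes it. Differences lying in exactly one
  summand thus become Hamming adjacency.\<close>

lemma graph_iso_Hamming2_if_direct_sum:
  fixes p :: "'v::ab_group_add \<Rightarrow> 'v"
  assumes fin: "finite (UNIV :: 'v set)"
    and p_diff: "\<And>u v. p (u - v) = p u - p v"
    and p_idem: "\<And>v. p (p v) = p v"
    and card_U: "card {v. p v = v} = n" and card_W: "card {v. p v = 0} = n"
    and edge: "\<And>u v. {u, v} \<in> P \<longleftrightarrow> v \<noteq> u \<and> (p (v - u) = v - u \<or> p (v - u) = 0)"
  shows "graph_iso (UNIV, P) (Hamming2 n)"
proof -
  define q where "q v = v - p v" for v
  have q0: "p (q v) = 0" for v by (simp add: q_def p_diff p_idem)
  obtain \<alpha> where \<alpha>: "bij_betw \<alpha> {v. p v = v} {..<n}"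
    using ex_bij_betw_finite_nat[of "{v. p v = v}"] card_U fin
    by (auto simp: atLeast0LessThan intro: finite_subset)
  obtain \<beta> where \<beta>: "bij_betw \<beta> {v. p v = 0} {..<n}"
    using ex_bij_betw_finite_nat[of "{v. p v = 0}"] card_W fin
    by (auto simp: atLeast0LessThan intro: finite_subset)
  define f where "f v = (\<alpha> (p v), \<beta> (q v))" for v
  have f_in: "f v \<in> {..<n} \<times> {..<n}" for v
    using bij_betwE[OF \<alpha>] bij_betwE[OF \<beta>] p_idem q0 by (auto simp: f_def)
  have \<alpha>_eq: "\<alpha> (p u) = \<alpha> (p v) \<longleftrightarrow> p (v - u) = 0" for u v
    using inj_onD[OF bij_betw_imp_inj_on[OF \<alpha>], of "p u" "p v"] p_idem by (auto simp: p_diff)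
  have \<beta>_eq: "\<beta> (q u) = \<beta> (q v) \<longleftrightarrow> p (v - u) = v - u" for u v
  proof -
    have "\<beta> (q u) = \<beta> (q v) \<longleftrightarrow> q u = q v"
      using inj_onD[OF bij_betw_imp_inj_on[OF \<beta>], of "q u" "q v"] q0 by auto
    also have "\<dots> \<longleftrightarrow> p (v - u) = v - u"
      by (auto simp: q_def p_diff algebra_simps)
    finally show ?thesis .
  qed
  have "inj f"
    by (rule injI) (auto simp: f_def \<alpha>_eq \<beta>_eq)
  moreover have "range f = {..<n} \<times> {..<n}"
  proof (intro equalityI subsetI)
    fix x assume "x \<in> range f" then show "x \<in> {..<n} \<times> {..<n}" using f_in by auto
  next
    fix x assume x: "x \<in> {..<n} \<times> {..<n}"
    obtain u where u: "p u = u" "\<alpha> u = fst x"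
    proof -
      have "fst x \<in> \<alpha> ` {v. p v = v}" using bij_betw_imp_surj_on[OF \<alpha>] x by auto
      then show thesis using that by auto
    qed
    obtain w where w: "p w = 0" "\<beta> w = snd x"
    proof -
      have "snd x \<in> \<beta> ` {v. p v = 0}" using bij_betw_imp_surj_on[OF \<beta>] x by auto
      then show thesis using that by auto
    qed
    have p0: "p 0 = 0" using p_diff[of 0 0] by simp
    \<comment> \<open>The hypothesis on \<open>p\<close> speaks of differences, hence the sum is
      rewritten as one.\<close>
    have "p (u + w) = p (u - (0 - w))" by simp
    also have "\<dots> = u" unfolding p_diff using u w p0 by simp
    finally have "f (u + w) = x" using u w by (simp add: f_def q_def)
    then show "x \<in> range f" by blast
  qed
  ultimately have "bij_betw f UNIV ({..<n} \<times> {..<n})" by (simp add: bij_betw_def)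
  moreover have "{u, v} \<in> P \<longleftrightarrow> {f u, f v} \<in> snd (Hamming2 n)" for u v
  proof -
    \<comment> \<open>Only 0 is both fixed and killed by \<open>p\<close>, so distinct points never
      agree in both coordinates.\<close>
    have "p (v - u) = v - u \<Longrightarrow> p (v - u) = 0 \<Longrightarrow> v = u" by simp
    moreover have "p (u - u) = 0" using p_diff[of u u] by simp
    ultimately show ?thesis
      unfolding Hamming2_edge_iff[OF f_in f_in] edge by (auto simp: f_def \<alpha>_eq \<beta>_eq)
  qed
  ultimately show ?thesis
    unfolding graph_iso_def by (auto simp: Hamming2_def intro!: exI[of _ f])
qed

section \<open>Groups with central commutators and squares, and point stabilisers of order 2\<close>

text \<open>This isolates what the extraspecial group contributes, as plain functions under
  composition: commutators and squares lie in \<open>{id, z}\<close>, and so does every central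
  element. In the application the numbers 16 and 2 are 80/5 and 32/16.\<close>

locale additive_group_central_involution =
  fixes X :: "('v::ab_group_add \<Rightarrow> 'v) set" and z :: "'v \<Rightarrow> 'v"
  assumes three: "\<And>v::'v. v + v + v = 0"
    and comp_closed: "\<And>x y. x \<in> X \<Longrightarrow> y \<in> X \<Longrightarrow> x \<circ> y \<in> X"
    and id_in: "id \<in> X"
    and inverse_ex: "\<And>x. x \<in> X \<Longrightarrow> \<exists>y\<in>X. y \<circ> x = id \<and> x \<circ> y = id"
    and add: "\<And>x u v. x \<in> X \<Longrightarrow> x (u + v) = x u + x v"
    and z_in: "z \<in> X" and z_neq: "z \<noteq> id" and z_sq: "z \<circ> z = id"
    and commutator: "\<And>x y. x \<in> X \<Longrightarrow> y \<in> X \<Longrightarrow> x \<circ> y = y \<circ> x \<or> x \<circ> y = z \<circ> y \<circ> x"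
    and square: "\<And>x. x \<in> X \<Longrightarrow> x \<circ> x = id \<or> x \<circ> x = z"
    and central: "\<And>x. x \<in> X \<Longrightarrow> (\<And>y. y \<in> X \<Longrightarrow> x \<circ> y = y \<circ> x) \<Longrightarrow> x = id \<or> x = z"
    and stabilizer: "\<And>v. v \<noteq> 0 \<Longrightarrow> card {x\<in>X. x v = v} = 2"
    and orbit: "\<And>v. v \<noteq> 0 \<Longrightarrow> card ((\<lambda>x. x v) ` X) = 16"
begin

lemma zero: "x \<in> X \<Longrightarrow> x 0 = 0"
  using add[of x 0 0] by simp

lemma minus: "x \<in> X \<Longrightarrow> x (- v) = - x v"
  using add[of x v "- v"] zero[of x] by (simp add: eq_neg_iff_add_eq_0 add.commute)

lemma diff: "x \<in> X \<Longrightarrow> x (u - v) = x u - x v"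
  using add[of x u "- v"] minus[of x v] by simp

lemma stabilizer_eq:
  assumes "v \<noteq> 0" "x \<in> X" "x v = v" "x \<noteq> id" "y \<in> X" "y v = v"
  shows "y = id \<or> y = x"
proof -
  have fin: "finite {x\<in>X. x v = v}"
    using stabilizer[OF assms(1)] by (intro card_ge_0_finite) simp
  have "{id, x} = {x\<in>X. x v = v}"
    using assms id_in stabilizer[OF assms(1)] by (intro card_subset_eq fin) auto
  with assms show ?thesis by auto
qed

text \<open>If \<open>z\<close> fixed a nonzero \<open>v\<close>, then every square in
  \<open>X\<close> would fix \<open>v\<close>, so any \<open>x\<close> in \<open>X\<close> would fix
  \<open>v + x v\<close>, and so would \<open>z\<close>. When this sum is nonzero its stabiliser is
  \<open>{id, z}\<close>, which forces \<open>x v = v\<close>; otherwise \<open>x v = - v\<close>.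
  The orbit of \<open>v\<close> would have at most 2 points instead of 16.\<close>

lemma z_fixes_only_0:
  assumes "z v = v" shows "v = 0"
proof (rule ccontr)
  assume v: "v \<noteq> 0"
  have "x v = v \<or> x v = - v" if x: "x \<in> X" for x
  proof (cases "v + x v = 0")
    case True
    then show ?thesis by (simp add: eq_neg_iff_add_eq_0 add.commute)
  next
    case False
    \<comment> \<open>Centrality of \<open>z\<close> comes from the commutator law for
      \<open>z\<close> and \<open>x\<close>: its second alternative cancels to
      \<open>z = id\<close>.\<close>
    have comm: "z \<circ> x = x \<circ> z"
    proof (rule ccontr)
      assume "z \<circ> x \<noteq> x \<circ> z"
      with commutator[OF z_in x] have "z \<circ> x = z \<circ> (x \<circ> z)" by (simp add: comp_assoc)
      then have "(z \<circ> z) \<circ> x = (z \<circ> z) \<circ> (x \<circ> z)" by (simp only: comp_assoc)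
      then have xz: "x = x \<circ> z" by (simp add: z_sq)
      obtain y where "y \<circ> x = id" using inverse_ex[OF x] by blast
      then have "z = y \<circ> x \<circ> z" by simp
      also have "\<dots> = y \<circ> x" by (simp only: comp_assoc xz[symmetric])
      finally show False using \<open>y \<circ> x = id\<close> z_neq by simp
    qed
    have "x (x v) = v" using square[OF x] assms by (auto simp: fun_eq_iff)
    then have x_fix: "x (v + x v) = v + x v" by (simp add: add x add.commute)
    have "z (x v) = x v" using comm assms by (metis comp_apply)
    then have "z (v + x v) = v + x v" by (simp add: add z_in assms)
    then have "x = id \<or> x = z"
      using stabilizer_eq[OF False z_in _ z_neq x x_fix] by blast
    then show ?thesis using assms by auto
  qed
  then have "(\<lambda>x. x v) ` X \<subseteq> {v, - v}" by auto
  then have "card ((\<lambda>x. x v) ` X) \<le> card {v, - v}" by (intro card_mono) auto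
  also have "\<dots> \<le> 2" by (simp add: card_insert_if)
  finally show False using orbit[OF v] by simp
qed

text \<open>As \<open>z\<close> is an involution, it fixes \<open>v + z v\<close>, which must
  therefore vanish.\<close>

lemma z_eq_minus: "z v = - v"
proof -
  have "z (z v) = v" using z_sq by (simp add: fun_eq_iff)
  then have "z (v + z v) = v + z v" by (simp add: add z_in add.commute)
  then have "v + z v = 0" by (rule z_fixes_only_0)
  then show ?thesis by (simp add: eq_neg_iff_add_eq_0 add.commute)
qed

text \<open>The map \<open>p\<close> is the projection onto the fixed space of \<open>t\<close> along its \<open>-1\<close>-eigenspace; the
  factor \<open>1/2\<close> is \<open>-1\<close> in characteristic 3.\<close>

lemma orbit_eq_union_of_summands:
  assumes v: "v \<noteq> 0" and card_UNIV: "card (UNIV :: 'v set) = 81"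
  obtains p :: "'v \<Rightarrow> 'v" where
    "\<And>u w. p (u - w) = p u - p w" "\<And>u. p (p u) = p u"
    "card {u. p u = u} = 9" "card {u. p u = 0} = 9"
    "(\<lambda>x. x v) ` X = {u. u \<noteq> 0 \<and> (p u = u \<or> p u = 0)}"
proof -
  have fin: "finite (UNIV :: 'v set)" using card_UNIV by (intro card_ge_0_finite) simp
  have neg_double: "- (u + u) = u" for u :: 'v
    using minus_unique[OF three[of u]] .
  have "\<not> {x\<in>X. x v = v} \<subseteq> {id}"
  proof
    assume "{x\<in>X. x v = v} \<subseteq> {id}"
    then have "card {x\<in>X. x v = v} \<le> card {id :: 'v \<Rightarrow> 'v}"
      by (intro card_mono) auto
    then show False using stabilizer[OF v] by simp
  qed
  then obtain t where t: "t \<in> X" "t v = v" "t \<noteq> id" by blast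
  \<comment> \<open>The square of \<open>t\<close> fixes \<open>v\<close>, whereas \<open>z\<close>,
    the only possible square besides \<open>id\<close>, does not.\<close>
  have tt: "t (t u) = u" for u
    using stabilizer_eq[OF v t comp_closed[OF t(1) t(1)]] t
    by (metis comp_apply comp_id fun.map_id id_apply square z_eq_minus z_fixes_only_0 v)
  have "t \<noteq> z" using z_fixes_only_0 t v by blast
  \<comment> \<open>Being neither \<open>id\<close> nor \<open>z\<close>, the element
    \<open>t\<close> is not central. Since \<open>z\<close> is -1, failing to commute with
    \<open>t\<close> means anticommuting with it.\<close>
  then obtain g where g: "g \<in> X" "t \<circ> g \<noteq> g \<circ> t" using central[OF t(1)] t(3) by blast
  have tg: "t (g u) = - g (t u)" for u
    using commutator[OF t(1) g(1)] g(2) z_eq_minus by (auto simp: fun_eq_iff)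
  define p where "p u = - (u + t u)" for u
  have p_diff: "p (u - w) = p u - p w" for u w
    by (simp add: p_def diff t)
  have t_neg_iff: "p u = 0 \<longleftrightarrow> t u = - u" for u
    by (auto simp: p_def add_eq_0_iff)
  have t_fix_iff: "p u = u \<longleftrightarrow> t u = u" for u
  proof
    assume "p u = u"
    then have "u + t u = - u" by (metis minus_minus p_def)
    then have "u + u + t u = 0" by (simp add: add.assoc)
    then have "- (u + u) = t u" by (rule minus_unique)
    then show "t u = u" by (simp only: neg_double)
  next
    assume "t u = u" then show "p u = u" by (simp only: p_def neg_double)
  qed
  have p_idem: "p (p u) = p u" for u
    unfolding t_fix_iff by (simp add: p_def minus diff t tt)
  have inj_g: "inj g"
    using inverse_ex[OF g(1)] by (metis inj_on_id inj_on_imageI2)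
  \<comment> \<open>The injection \<open>g\<close> maps each eigenspace of \<open>t\<close> into the
    other, which gives both inequalities.\<close>
  have le1: "card {u. p u = u} \<le> card {u. p u = 0}"
    unfolding t_fix_iff t_neg_iff
    by (rule card_inj_on_le[of g]) (use inj_g fin tg in \<open>auto intro: inj_on_subset finite_subset\<close>)
  have le2: "card {u. p u = 0} \<le> card {u. p u = u}"
    unfolding t_fix_iff t_neg_iff
    by (rule card_inj_on_le[of g])
       (use inj_g fin tg minus g in \<open>auto intro: inj_on_subset finite_subset\<close>)
  have p0: "p 0 = 0" using p_diff[of 0 0] by simp
  have p_add: "p (u + w) = p u + p w" for u w
    using p_diff[of u "0 - w"] p_diff[of 0 w] p0 by simp
  \<comment> \<open>The space is the direct sum of the two eigenspaces, so the product of their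
    equal sizes is 81.\<close>
  have "bij_betw (\<lambda>u. (p u, u - p u)) UNIV ({u. p u = u} \<times> {u. p u = 0})"
    by (rule bij_betwI[where g = "\<lambda>(a, b). a + b"]) (auto simp: p_idem p_diff p_add)
  from bij_betw_same_card[OF this]
  have "card {u. p u = u} * card {u. p u = u} = 9 * 9"
    using le1 le2 by (simp add: card_UNIV card_cartesian_product)
  then have c9: "card {u. p u = u} = 9" by (metis power2_eq_square power2_eq_iff_nonneg le0)
  then have c9': "card {u. p u = 0} = 9" using le1 le2 by simp
  have sub: "(\<lambda>x. x v) ` X \<subseteq> {u. u \<noteq> 0 \<and> (p u = u \<or> p u = 0)}"
  proof (intro image_subsetI CollectI conjI)
    fix x assume x: "x \<in> X"
    show "x v \<noteq> 0" using inverse_ex[OF x] zero v by (metis comp_apply id_apply)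
    show "p (x v) = x v \<or> p (x v) = 0"
      unfolding t_fix_iff t_neg_iff using commutator[OF t(1) x] z_eq_minus t(2)
      by (auto simp: fun_eq_iff)
  qed
  \<comment> \<open>The eigenspaces meet only in 0, so the union has 8 + 8 = 16 nonzero vectors;
    this is the orbit size, and the inclusion is an equality.\<close>
  have "{u. u \<noteq> 0 \<and> (p u = u \<or> p u = 0)} = ({u. p u = u} - {0}) \<union> ({u. p u = 0} - {0})" by auto
  also have "card \<dots> = card ({u. p u = u} - {0}) + card ({u. p u = 0} - {0})"
    by (rule card_Un_disjoint) (auto intro: finite_subset[OF subset_UNIV fin])
  also have "\<dots> = 16" using c9 c9' p0 by simp
  finally have "(\<lambda>x. x v) ` X = {u. u \<noteq> 0 \<and> (p u = u \<or> p u = 0)}"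
    using orbit[OF v] by (intro card_subset_eq finite_subset[OF subset_UNIV fin] sub) simp
  with p_diff p_idem c9 c9' show thesis by (rule that)
qed

end

section \<open>Permutation groups on a type\<close>

text \<open>On \<open>UNIV\<close> the extensionality built into \<open>BijGroup\<close> is vacuous,
  so its product is ordinary composition.\<close>

lemma BijGroup_UNIV_simps:
  "carrier (BijGroup UNIV) = {f. bij f}"
  "\<one>\<^bsub>BijGroup UNIV\<^esub> = id"
  "bij f \<Longrightarrow> bij g \<Longrightarrow> f \<otimes>\<^bsub>BijGroup UNIV\<^esub> g = f \<circ> g"
  by (auto simp: BijGroup_def Bij_def compose_def fun_eq_iff extensional_def)

lemma subgroup_BijGroup_UNIV_inverse:
  assumes "subgroup X (BijGroup UNIV)" "x \<in> X"
  shows "\<exists>y\<in>X. y \<circ> x = id \<and> x \<circ> y = id"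
proof -
  interpret subgroup X "BijGroup UNIV" by fact
  interpret group "BijGroup (UNIV :: 'a set)" by (rule group_BijGroup)
  let ?y = "inv\<^bsub>BijGroup UNIV\<^esub> x"
  have y: "?y \<in> X" using assms(2) by (rule m_inv_closed)
  have bij: "bij x" "bij ?y"
    using mem_carrier[OF assms(2)] mem_carrier[OF y] by (simp_all add: BijGroup_UNIV_simps)
  have "?y \<circ> x = id" "x \<circ> ?y = id"
    using l_inv[of x] r_inv[of x] bij by (simp_all add: BijGroup_UNIV_simps)
  with y show ?thesis by blast
qed

text \<open>The fibre of the evaluation at \<open>v\<close> over \<open>a v\<close> is the left
  coset of the stabiliser by \<open>a\<close>. All fibres therefore have the same size, and together
  they exhaust \<open>X\<close>.\<close>

lemma card_orbit_mult_card_stabilizer: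
  assumes comp: "\<And>x y. x \<in> X \<Longrightarrow> y \<in> X \<Longrightarrow> x \<circ> y \<in> X"
    and inv: "\<And>x. x \<in> X \<Longrightarrow> \<exists>y\<in>X. y \<circ> x = id \<and> x \<circ> y = id"
    and fin: "finite X"
  shows "card ((\<lambda>x. x v) ` X) * card {x\<in>X. x v = v} = card X"
proof -
  have "card {x\<in>X. x v = w} = card {x\<in>X. x v = v}" if w: "w \<in> (\<lambda>x. x v) ` X" for w
  proof -
    obtain a where a: "a \<in> X" "w = a v" using w by blast
    obtain b where b: "b \<in> X" "b \<circ> a = id" "a \<circ> b = id" using inv a by blast
    have ab: "a (b u) = u" "b (a u) = u" for u using b by (auto simp: fun_eq_iff)
    have "bij_betw (\<lambda>x. b \<circ> x) {x\<in>X. x v = w} {x\<in>X. x v = v}"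
      by (rule bij_betwI[where g = "\<lambda>x. a \<circ> x"]) (use a b ab comp in \<open>auto simp: fun_eq_iff\<close>)
    then show ?thesis by (rule bij_betw_same_card)
  qed
  then have "(\<Sum>w\<in>(\<lambda>x. x v) ` X. card {x\<in>X. x v = w})
      = card ((\<lambda>x. x v) ` X) * card {x\<in>X. x v = v}" by simp
  moreover have "(\<Sum>w\<in>(\<lambda>x. x v) ` X. card {x\<in>X. x v = w}) = card X"
    using sum.image_gen[OF fin, of "\<lambda>_. 1::nat" "\<lambda>x. x v"] by simp
  ultimately show ?thesis by simp
qed

section \<open>Extraspecial groups\<close>

text \<open>The cosets of \<open>x\<close> and \<open>y\<close> commute, so their product, which
  contains \<open>xy\<close>, also consists of elements \<open>(c y)(d x)\<close> with
  \<open>c\<close> and \<open>d\<close> central. Moving \<open>d\<close> to the front leaves the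
  central factor \<open>cd\<close>.\<close>

lemma FactGroup_center_commute:
  assumes "group G" "comm_group (G Mod center G)" "x \<in> carrier G" "y \<in> carrier G"
  shows "\<exists>c\<in>center G. x \<otimes>\<^bsub>G\<^esub> y = c \<otimes>\<^bsub>G\<^esub> (y \<otimes>\<^bsub>G\<^esub> x)"
proof -
  interpret group G by fact
  let ?Z = "center G"
  have one: "\<one>\<^bsub>G\<^esub> \<in> ?Z" by (auto simp: center_def)
  have "(?Z #>\<^bsub>G\<^esub> x) <#>\<^bsub>G\<^esub> (?Z #>\<^bsub>G\<^esub> y) = (?Z #>\<^bsub>G\<^esub> y) <#>\<^bsub>G\<^esub> (?Z #>\<^bsub>G\<^esub> x)"
    using comm_groupE(4)[OF assms(2), of "?Z #>\<^bsub>G\<^esub> x" "?Z #>\<^bsub>G\<^esub> y"] assms(3,4)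
    by (auto simp: FactGroup_def RCOSETS_def)
  moreover have "x \<otimes>\<^bsub>G\<^esub> y \<in> (?Z #>\<^bsub>G\<^esub> x) <#>\<^bsub>G\<^esub> (?Z #>\<^bsub>G\<^esub> y)"
    unfolding set_mult_def r_coset_def using one assms(3,4) by force
  ultimately obtain c d where cd: "c \<in> ?Z" "d \<in> ?Z"
    "x \<otimes>\<^bsub>G\<^esub> y = (c \<otimes>\<^bsub>G\<^esub> y) \<otimes>\<^bsub>G\<^esub> (d \<otimes>\<^bsub>G\<^esub> x)"
    unfolding set_mult_def r_coset_def by auto
  have car: "c \<in> carrier G" "d \<in> carrier G" and dy: "y \<otimes>\<^bsub>G\<^esub> d = d \<otimes>\<^bsub>G\<^esub> y"
    using cd assms(4) by (auto simp: center_def)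
  have "x \<otimes>\<^bsub>G\<^esub> y = c \<otimes>\<^bsub>G\<^esub> (y \<otimes>\<^bsub>G\<^esub> d) \<otimes>\<^bsub>G\<^esub> x"
    using cd(3) car assms(3,4) by (simp add: m_assoc)
  then have eq: "x \<otimes>\<^bsub>G\<^esub> y = (c \<otimes>\<^bsub>G\<^esub> d) \<otimes>\<^bsub>G\<^esub> (y \<otimes>\<^bsub>G\<^esub> x)"
    unfolding dy using car assms(3,4) by (simp add: m_assoc)
  have "(c \<otimes>\<^bsub>G\<^esub> d) \<otimes>\<^bsub>G\<^esub> u = u \<otimes>\<^bsub>G\<^esub> (c \<otimes>\<^bsub>G\<^esub> d)" if u: "u \<in> carrier G" for u
  proof -
    have "c \<otimes>\<^bsub>G\<^esub> u = u \<otimes>\<^bsub>G\<^esub> c" "d \<otimes>\<^bsub>G\<^esub> u = u \<otimes>\<^bsub>G\<^esub> d" using cd u by (auto simp: center_def)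
    then show ?thesis using car u by (metis m_assoc)
  qed
  then have "c \<otimes>\<^bsub>G\<^esub> d \<in> ?Z" using car by (simp add: center_def)
  with eq show ?thesis by blast
qed

lemma FactGroup_center_square:
  assumes "group G" "elementary_abelian 2 (G Mod center G)" "x \<in> carrier G"
  shows "x \<otimes>\<^bsub>G\<^esub> x \<in> center G"
proof -
  interpret group G by fact
  let ?Z = "center G"
  interpret Q: comm_group "G Mod ?Z" using assms(2) by (simp add: elementary_abelian_def)
  have car: "?Z #>\<^bsub>G\<^esub> x \<in> carrier (G Mod ?Z)"
    using assms(3) by (auto simp: FactGroup_def RCOSETS_def)
  then have "(?Z #>\<^bsub>G\<^esub> x) [^]\<^bsub>G Mod ?Z\<^esub> (2::nat) = \<one>\<^bsub>G Mod ?Z\<^esub>"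
    using assms(2) by (simp add: elementary_abelian_def)
  then have "(?Z #>\<^bsub>G\<^esub> x) <#>\<^bsub>G\<^esub> (?Z #>\<^bsub>G\<^esub> x) = ?Z"
    \<comment> \<open>Powers are built up from the identity, so the square unfolds with a leading
      identity coset that \<open>Q.l_one\<close> removes.\<close>
    using Q.l_one[OF car] by (simp add: numeral_2_eq_2 FactGroup_def)
  moreover have "\<one>\<^bsub>G\<^esub> \<in> ?Z" by (auto simp: center_def)
  then have "x \<otimes>\<^bsub>G\<^esub> x \<in> (?Z #>\<^bsub>G\<^esub> x) <#>\<^bsub>G\<^esub> (?Z #>\<^bsub>G\<^esub> x)"
    unfolding set_mult_def r_coset_def using assms(3) by force
  ultimately show ?thesis by simp
qed

text \<open>A centre of order 2 is \<open>{id, z}\<close>, so the central factors of the two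
  preceding lemmas are \<open>id\<close> or \<open>z\<close>. In particular
  \<open>z \<circ> z\<close> is central and, by injectivity of \<open>z\<close>, differs from
  \<open>z\<close>.\<close>

lemma extraspecial_perm_group_UNIV:
  assumes X: "subgroup X (BijGroup UNIV)" and es: "extraspecial 2 (perm_group UNIV X)"
  obtains z where "z \<in> X" "z \<noteq> id" "z \<circ> z = id"
    "\<And>x y. x \<in> X \<Longrightarrow> y \<in> X \<Longrightarrow> x \<circ> y = y \<circ> x \<or> x \<circ> y = z \<circ> y \<circ> x"
    "\<And>x. x \<in> X \<Longrightarrow> x \<circ> x = id \<or> x \<circ> x = z"
    "\<And>x. x \<in> X \<Longrightarrow> (\<And>y. y \<in> X \<Longrightarrow> x \<circ> y = y \<circ> x) \<Longrightarrow> x = id \<or> x = z"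
proof -
  let ?G = "perm_group UNIV X"
  have bij: "bij x" if "x \<in> X" for x
    using subgroup.mem_carrier[OF X that] by (simp add: BijGroup_UNIV_simps)
  have mult: "x \<otimes>\<^bsub>?G\<^esub> y = x \<circ> y" if "x \<in> X" "y \<in> X" for x y
    using that bij by (simp add: BijGroup_UNIV_simps)
  have id_in: "id \<in> X" using subgroup.one_closed[OF X] by (simp add: BijGroup_UNIV_simps)
  have comp: "x \<circ> y \<in> X" if "x \<in> X" "y \<in> X" for x y
    using subgroup.m_closed[OF X that] mult[OF that] by simp
  have grp: "group ?G" and ea: "elementary_abelian 2 (?G Mod center ?G)"
    and c2: "card (center ?G) = 2"
    using es by (auto simp: extraspecial_def)
  have cen: "center ?G = {c\<in>X. \<forall>x\<in>X. c \<circ> x = x \<circ> c}"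
    using mult by (auto simp: center_def)
  have "id \<in> center ?G" using id_in by (simp add: cen)
  moreover obtain c d where "center ?G = {c, d}" "c \<noteq> d" using c2 by (auto simp: card_2_iff)
  ultimately obtain z where z: "center ?G = {id, z}" "z \<noteq> id" by auto
  have zX: "z \<in> X" using z(1) by (auto simp: cen)
  have "z \<circ> z \<in> center ?G"
    using FactGroup_center_square[OF grp ea, of z] mult[OF zX zX] zX by simp
  moreover have "z \<circ> z \<noteq> z" using z(2) bij[OF zX]
    by (metis bij_is_inj comp_apply fun_eq_iff id_apply injD)
  ultimately have zz: "z \<circ> z = id" using z(1) by auto
  show thesis
  proof (rule that[OF zX z(2) zz])
    fix x y assume xy: "x \<in> X" "y \<in> X"
    obtain c where c: "c \<in> center ?G" "x \<otimes>\<^bsub>?G\<^esub> y = c \<otimes>\<^bsub>?G\<^esub> (y \<otimes>\<^bsub>?G\<^esub> x)"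
      using FactGroup_center_commute[OF grp, of x y] ea xy by (auto simp: elementary_abelian_def)
    have "c \<in> X" using c by (simp add: cen)
    then have "x \<circ> y = c \<circ> (y \<circ> x)" using c(2) mult xy comp by metis
    then show "x \<circ> y = y \<circ> x \<or> x \<circ> y = z \<circ> y \<circ> x" using c(1) z(1) by (auto simp: comp_assoc)
  next
    fix x assume x: "x \<in> X"
    show "x \<circ> x = id \<or> x \<circ> x = z"
      using FactGroup_center_square[OF grp ea, of x] mult[OF x x] x z(1) by simp
  next
    fix x assume "x \<in> X" "\<And>y. y \<in> X \<Longrightarrow> x \<circ> y = y \<circ> x"
    then have "x \<in> center ?G" by (simp add: cen)
    then show "x = id \<or> x = z" by (simp add: z(1))
  qed
qed

section \<open>The factors\<close>

text \<open>Two pigeonhole arguments give characteristic 3. If 1 + 1 were 0, a third element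
  \<open>a\<close> would yield four elements 0, 1, \<open>a\<close>, \<open>a + 1\<close>; and if
  \<open>c = 1 + 1\<close> had \<open>c + 1\<close> nonzero, then 0, 1, \<open>c\<close>,
  \<open>c + 1\<close> would be four.\<close>

lemma triple_eq_0_if_CARD_3:
  assumes "CARD('f::field) = 3"
  shows "(v :: 'f ^ 'n) + v + v = 0"
proof -
  have fin: "finite (UNIV :: 'f set)" using assms by (intro card_ge_0_finite) simp
  have *: "card A \<le> 3" for A :: "'f set" using card_mono[OF fin, of A] assms by simp
  have "1 + 1 \<noteq> (0::'f)"
  proof
    assume two: "1 + 1 = (0::'f)"
    have "UNIV \<noteq> {0, 1::'f}"
    proof
      assume "UNIV = {0, 1::'f}"
      then have "CARD('f) = card {0, 1::'f}" by simp
      then show False using assms by simp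
    qed
    then obtain a :: 'f where a: "a \<noteq> 0" "a \<noteq> 1" by blast
    have "a + 1 \<noteq> 0" using two a(2) by (metis add_right_cancel)
    then have "card {0, 1, a, a + 1} = 4" using a by (auto simp: card_insert_if)
    with *[of "{0, 1, a, a + 1}"] show False by simp
  qed
  moreover define c :: 'f where "c = 1 + 1"
  ultimately have c: "c \<noteq> 0" "c \<noteq> 1" "c + 1 \<noteq> 1"
    by (simp_all only: add_cancel_left_left add_cancel_left_right one_neq_zero not_False_eq_True
        add_cancel_right_right add_cancel_right_left)
  have "c + 1 = 0"
  proof (rule ccontr)
    assume "c + 1 \<noteq> 0"
    then have "card {0, 1, c, c + 1} = 4" using c by (auto simp: card_insert_if)
    with *[of "{0, 1, c, c + 1}"] show False by simp
  qed
  then have three: "1 + 1 + 1 = (0::'f)" by (simp only: c_def)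
  have "a + a + a = 0" for a :: 'f
  proof -
    have "a + a + a = a * (1 + 1 + 1)" by (simp only: distrib_left mult_1_right)
    then show ?thesis by (simp only: three mult_zero_right)
  qed
  then show ?thesis by (simp add: vec_eq_iff)
qed

theorem theorem6p9:
  fixes M G G\<^sub>0 X :: "('f::field ^ 4 \<Rightarrow> 'f ^ 4) set"
    and \<E> :: "('f ^ 4) set set set"
    and \<Gamma> :: "nat \<Rightarrow> ('f ^ 4) graph"
    and S :: "nat \<Rightarrow> ('f ^ 4) set"
  assumes "CARD('f) = 3"
    and "homogeneous_factorisation 5 M G UNIV \<E>"
    and "bij_betw \<Gamma> {1..5} (factors UNIV \<E>)"
    and "\<And>b. b \<in> {1..5} \<Longrightarrow> \<Gamma> b = Cay UNIV (S b)"
    and "\<And>b. b \<in> {1..5} \<Longrightarrow> arc_transitive M (\<Gamma> b)"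
    and "subgroup G\<^sub>0 (BijGroup UNIV)" and "G\<^sub>0 \<subseteq> GL"
    and "semidirect (BijGroup UNIV) G translation_group G\<^sub>0"
    and "two_transitive G UNIV"
    and "X \<lhd> perm_group UNIV G\<^sub>0"
    and "extraspecial 2 (perm_group UNIV X)"
    and "order (perm_group UNIV X) = 2 ^ 5"
    and "\<exists>H. subgroup H (sym_group 5) \<and>
             perm_group UNIV G\<^sub>0 Mod X \<cong> (sym_group 5)\<lparr>carrier := H\<rparr>"
    and "semidirect (BijGroup UNIV) M translation_group X"
  shows "\<forall>b\<in>{1..5}. graph_iso (\<Gamma> b) (Hamming2 9)"
proof -
  let ?V = "UNIV :: ('f ^ 4) set"
  have card_V: "card ?V = 81" using assms(1) by simp
  have fin: "finite ?V" using card_V by (intro card_ge_0_finite) simp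
  have part: "partition_on {e. e \<subseteq> ?V \<and> card e = 2} \<E>" and card_\<E>: "card \<E> = 5"
    and act: "transitive_action (perm_group UNIV G) \<E> (part_action \<E>)"
    using assms(2) by (auto simp: homogeneous_factorisation_def)

  \<comment> \<open>The linear action of the extraspecial group\<close>
  have sub0: "subgroup X (perm_group UNIV G\<^sub>0)" using assms(10) by (rule normal_imp_subgroup)
  have X: "subgroup X (BijGroup UNIV)"
    using group.incl_subgroup[OF group_BijGroup assms(6) sub0] .
  have X_GL: "X \<subseteq> GL" using subgroup.subset[OF sub0] assms(7) by auto
  have add: "x (u + v) = x u + x v" if "x \<in> X" for x u v
    using that X_GL by (auto simp: GL_def matrix_vector_right_distrib)
  have x0: "x 0 = 0" if "x \<in> X" for x using add[OF that, of 0 0] by simp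
  have bijX: "bij x" if "x \<in> X" for x
    using subgroup.mem_carrier[OF X that] by (simp add: BijGroup_UNIV_simps)
  have comp: "x \<circ> y \<in> X" if "x \<in> X" "y \<in> X" for x y
    using subgroup.m_closed[OF X that] bijX that by (simp add: BijGroup_UNIV_simps)
  have card_X: "card X = 32" using assms(12) by (simp add: order_def)
  have id_in: "id \<in> X" using subgroup.one_closed[OF X] by (simp add: BijGroup_UNIV_simps)

  \<comment> \<open>Neighbourhoods of 0 as orbits of size 16\<close>
  define D where "D P = {v. {0, v} \<in> P}" for P :: "('f ^ 4) set set"
  have edge_card: "card e = 2" if "P \<in> \<E>" "e \<in> P" for P e
    using part that by (auto simp: partition_on_def)
  have D_nonzero: "v \<noteq> 0" if "P \<in> \<E>" "v \<in> D P" for P v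
    using edge_card[OF that(1), of "{0, v}"] that(2) by (auto simp: D_def)
  have part_Cay: "\<exists>C. (UNIV, P) = Cay UNIV C \<and> arc_transitive M (UNIV, P)" if "P \<in> \<E>" for P
  proof -
    have "(UNIV, P) \<in> \<Gamma> ` {1..5}"
      using that assms(3) by (auto simp: bij_betw_def factors_def)
    then show ?thesis using assms(4,5) by fastforce
  qed
  have edge_iff: "{u, v} \<in> P \<longleftrightarrow> v - u \<in> D P" if "P \<in> \<E>" for P u v
  proof -
    obtain C where "P = {{u, v} | u v. v - u \<in> C}" using part_Cay[OF \<open>P \<in> \<E>\<close>] by (auto simp: Cay_def)
    \<comment> \<open>Edges are unordered and \<open>C\<close> is not assumed closed under negation;
      \<open>D P\<close> is \<open>C\<close> together with the negatives of its elements.\<close>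
    then have "{u, v} \<in> P \<longleftrightarrow> v - u \<in> C \<or> u - v \<in> C" for u v
      by (auto simp: doubleton_eq_iff)
    then show ?thesis by (simp add: D_def)
  qed
  have D_nonempty: "D P \<noteq> {}" if "P \<in> \<E>" for P
  proof -
    obtain e where e: "e \<in> P" using partition_onD3[OF part] \<open>P \<in> \<E>\<close> by (metis ex_in_conv)
    obtain u v where "e = {u, v}" using edge_card[OF \<open>P \<in> \<E>\<close> e] by (auto simp: card_2_iff)
    then show ?thesis using edge_iff[OF that] e by blast
  qed
  have D_transitive: "\<exists>x\<in>X. x v = w" if P: "P \<in> \<E>" and vw: "v \<in> D P" "w \<in> D P" for P v w
  proof -
    have "(0, v) \<in> arcs (UNIV, P)" "(0, w) \<in> arcs (UNIV, P)" using vw by (auto simp: arcs_def D_def)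
    then obtain m where m: "m \<in> M" "m 0 = 0" "m v = w"
      using part_Cay[OF P] unfolding arc_transitive_def by fast
    have "translation_group <#>\<^bsub>BijGroup UNIV\<^esub> X = M"
      using assms(14) by (simp add: semidirect_def)
    \<comment> \<open>Since \<open>m\<close> and \<open>x\<close> both fix 0, the translation part
      \<open>a\<close> is 0 and \<open>m\<close> acts as \<open>x\<close>.\<close>
    then obtain a x where ax: "x \<in> X" "m = (\<lambda>v. v + a) \<otimes>\<^bsub>BijGroup UNIV\<^esub> x"
      using m(1) by (auto simp: set_mult_def translation_group_def)
    have "bij (\<lambda>v::'f ^ 4. v + a)" by (simp add: bij_plus_right)
    then have "m = (\<lambda>v. v + a) \<circ> x" using ax bijX by (simp add: BijGroup_UNIV_simps)
    then have "x v = w" using m x0[OF ax(1)] by simp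
    with ax(1) show ?thesis by blast
  qed
  have D_image: "card (D P) \<le> card (D Q)" if P: "P \<in> \<E>" and Q: "Q \<in> \<E>" for P Q
  proof -
    obtain v w where vw: "v \<in> D P" "w \<in> D Q" using D_nonempty P Q by blast
    \<comment> \<open>The image of \<open>P\<close> under this \<open>g\<close> is a part sharing
      the edge \<open>{0, w}\<close> with \<open>Q\<close>, hence equals \<open>Q\<close>. So
      \<open>g\<close> embeds \<open>D P\<close> into \<open>D Q\<close>; exchanging the parts later
      gives equal sizes.\<close>
    obtain g where g: "g \<in> G" "g 0 = 0" "g v = w"
      using assms(9) D_nonzero[OF P vw(1)] D_nonzero[OF Q vw(2)]
      unfolding two_transitive_def by fastforce
    interpret A: transitive_action "perm_group UNIV G" \<E> "part_action \<E>" by (rule act)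
    have "part_action \<E> g P \<in> \<E>"
      using A.element_image[of g P "part_action \<E> g P"] g(1) P by simp
    then have gP: "(\<lambda>e. g ` e) ` P \<in> \<E>" using P by (simp add: part_action_def)
    have sub: "{0, g u} \<in> (\<lambda>e. g ` e) ` P" if "u \<in> D P" for u
    proof -
      have "g ` {0, u} \<in> (\<lambda>e. g ` e) ` P" using that by (intro imageI) (simp add: D_def)
      then show ?thesis by (simp add: g(2))
    qed
    have "{0, w} \<in> (\<lambda>e. g ` e) ` P" using sub[OF vw(1)] by (simp only: g(3))
    then have "(\<lambda>e. g ` e) ` P = Q"
      using disjointD[OF partition_onD2[OF part] gP Q] vw(2) unfolding D_def by blast
    then have "g ` D P \<subseteq> D Q" using sub by (auto simp: D_def)
    moreover have "inj g"
    proof -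
      have "subgroup G (BijGroup UNIV)" using assms(2) by (simp add: homogeneous_factorisation_def)
      then have "bij g" using subgroup.mem_carrier[of G "BijGroup UNIV" g] g
        by (simp add: BijGroup_UNIV_simps)
      then show ?thesis by (rule bij_is_inj)
    qed
    ultimately show ?thesis
      by (intro card_inj_on_le[of g]) (auto intro: inj_on_subset finite_subset[OF subset_UNIV fin])
  qed
  have D_cover: "\<exists>P\<in>\<E>. v \<in> D P" if "v \<noteq> 0" for v
  proof -
    have "{0, v} \<in> \<Union>\<E>" using partition_onD1[OF part] that by auto
    then show ?thesis by (auto simp: D_def)
  qed
  have card_D: "card (D P) = 16" if P: "P \<in> \<E>" for P
  proof -
    \<comment> \<open>The 80 nonzero vectors fall into five disjoint sets of equal size.\<close>
    have "UNIV - {0} = (\<Union>Q\<in>\<E>. D Q)" using D_cover D_nonzero by blast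
    moreover have "card (\<Union>Q\<in>\<E>. D Q) = (\<Sum>Q\<in>\<E>. card (D Q))"
    proof (rule card_UN_disjoint)
      show "finite \<E>" using card_\<E> by (intro card_ge_0_finite) simp
      show "\<forall>Q\<in>\<E>. finite (D Q)" by (auto intro: finite_subset[OF subset_UNIV fin])
      show "\<forall>Q\<in>\<E>. \<forall>R\<in>\<E>. Q \<noteq> R \<longrightarrow> D Q \<inter> D R = {}"
        using disjointD[OF partition_onD2[OF part]] unfolding D_def by blast
    qed
    moreover have "(\<Sum>Q\<in>\<E>. card (D Q)) = (\<Sum>Q\<in>\<E>. card (D P))"
      using D_image P by (intro sum.cong refl antisym) auto
    moreover have "card (UNIV - {0 :: 'f ^ 4}) = 80" using card_V fin by (simp add: card_Diff_singleton)
    ultimately show ?thesis using card_\<E> by simp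
  qed
  have X_invariant: "x v \<in> D P" if P: "P \<in> \<E>" and "x \<in> X" "v \<in> D P" for P x v
  proof -
    have "X \<subseteq> M"
      using assms(14) subgroup.subset[of X "perm_group UNIV M"] by (simp add: semidirect_def)
    \<comment> \<open>Arc-transitivity includes that \<open>M\<close>, and with it \<open>X\<close>,
      acts by automorphisms of each factor.\<close>
    then have "x \<in> graph_Aut (UNIV, P)"
      using part_Cay[OF P] that(2) unfolding arc_transitive_def by blast
    then have "{x 0, x v} \<in> P" using that(3) by (auto simp: graph_Aut_def D_def)
    then show ?thesis using x0[OF that(2)] by (simp add: D_def)
  qed
  have D_orbit: "(\<lambda>x. x v) ` X = D P" if P: "P \<in> \<E>" and v: "v \<in> D P" for P v
    using X_invariant[OF P _ v] D_transitive[OF P v] by blast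
  have orbit: "card ((\<lambda>x. x v) ` X) = 16" if "v \<noteq> 0" for v
    using D_cover[OF that] D_orbit card_D by metis
  have stab: "card {x\<in>X. x v = v} = 2" if "v \<noteq> 0" for v
  proof -
    have "finite X" using card_X by (intro card_ge_0_finite) simp
    from card_orbit_mult_card_stabilizer[OF comp subgroup_BijGroup_UNIV_inverse[OF X] this, of v]
    show ?thesis using orbit[OF that] card_X by simp
  qed

  \<comment> \<open>The central involution and identification of the factors\<close>
  obtain z where z: "z \<in> X" "z \<noteq> id" "z \<circ> z = id"
    "\<And>x y. x \<in> X \<Longrightarrow> y \<in> X \<Longrightarrow> x \<circ> y = y \<circ> x \<or> x \<circ> y = z \<circ> y \<circ> x"
    "\<And>x. x \<in> X \<Longrightarrow> x \<circ> x = id \<or> x \<circ> x = z"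
    "\<And>x. x \<in> X \<Longrightarrow> (\<And>y. y \<in> X \<Longrightarrow> x \<circ> y = y \<circ> x) \<Longrightarrow> x = id \<or> x = z"
    using extraspecial_perm_group_UNIV[OF X assms(11)] by blast
  interpret additive_group_central_involution X z
    by unfold_locales
      (fact triple_eq_0_if_CARD_3[OF assms(1)] comp id_in
        subgroup_BijGroup_UNIV_inverse[OF X] add z stab orbit)+

  show ?thesis
  proof
    fix b :: nat assume "b \<in> {1..5}"
    then have "\<Gamma> b \<in> factors UNIV \<E>" using assms(3) by (auto simp: bij_betw_def)
    then obtain P where P: "P \<in> \<E>" "\<Gamma> b = (UNIV, P)" by (auto simp: factors_def)
    obtain v where v: "v \<in> D P" using D_nonempty[OF P(1)] by blast
    obtain p :: "'f ^ 4 \<Rightarrow> 'f ^ 4" where p: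
      "\<And>u w. p (u - w) = p u - p w" "\<And>u. p (p u) = p u"
      "card {u. p u = u} = 9" "card {u. p u = 0} = 9"
      "(\<lambda>x. x v) ` X = {u. u \<noteq> 0 \<and> (p u = u \<or> p u = 0)}"
      by (rule orbit_eq_union_of_summands[OF D_nonzero[OF P(1) v] card_V]) (rule that)
    show "graph_iso (\<Gamma> b) (Hamming2 9)"
      unfolding P(2)
    proof (rule graph_iso_Hamming2_if_direct_sum[OF fin p(1-4)])
      fix u w
      show "{u, w} \<in> P \<longleftrightarrow> w \<noteq> u \<and> (p (w - u) = w - u \<or> p (w - u) = 0)"
        \<comment> \<open>Adjacency means that \<open>w - u\<close> lies in the orbit of
          \<open>v\<close>, the set of nonzero vectors of the two summands; being nonzero is
          \<open>w \<noteq> u\<close>.\<close>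
        using edge_iff[OF P(1)] D_orbit[OF P(1) v] p(5) by auto
    qed
  qed
qed

end
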